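(* Let $X$ be a nonempty set. Then $\mathsf{B}_{\mathrm{id,rd}}[X]=(\mathbb{B}_{\mathrm{id,rd}}[X],+_{\mathrm{id}},\times_{\mathrm{rd}},0,1)$, the set of id-reduced polynomials over $X$ with the addition $+_{\mathrm{id}}$ and (the restriction of) the multiplication $\times_{\mathrm{rd}}$, is an idempotent right-distributive strong bimonoid.
   Context: A strong bimonoid is an algebra $(B,\oplus,\otimes,\mathbf 0,\mathbf 1)$ such that $(B,\oplus,\mathbf 0)$ is a commutative monoid, $(B,\otimes,\mathbf 1)$ is a monoid, and $b\otimes\mathbf 0=\mathbf 0\otimes b=\mathbf 0$ for all $b$. It is right-distributive if $(a\oplus b)\otimes c=(a\otimes c)\oplus(b\otimes c)$ for all $a,b,c$, and idempotent if $b\oplus b=b$ for all $b$. Terms. $\mathrm{T}(X)$ is the set of all terms built from elements of $X$, constants $\hat 0,\hat 1$, and binary symbols $\hat+,\hat\times$ (infix). $\mathrm{size}(t)$ is the total number of occurrences of symbols (elements of $X$, constants, binary symbols) in $t$. Simple terms. $s\in \mathrm{T}(X)$ is simple if $s=\hat 0$, or $s$ contains neither $\hat 0$ nor any subterm of the form $\hat 1\hat\times s'$ or $s'\hat\times\hat 1$. $\mathrm{ST}(X)$ is the set of simple terms. For $s,t\in \mathrm{ST}(X)$, $s=_{\mathrm{AC}}t$ means that $t$ is obtained from $s$ by finitely many steps, each replacing a subterm occurrence using, in either direction, one of: $a\hat+(b\hat+c)\leftrightarrow(a\hat+b)\hat+c$, $a\hat+b\leftrightarrow b\hat+a$, $a\hat\times(b\hat\times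 c)\leftrightarrow(a\hat\times b)\hat\times c$. $[s]_{\mathrm{AC}}$ is the class of $s$; $\mathbb{N}_{\mathrm{sb}}[X]=\mathrm{ST}(X)/{=_{\mathrm{AC}}}$; $0=[\hat 0]_{\mathrm{AC}}$, $1=[\hat 1]_{\mathrm{AC}}$; $X/\mathrm{AC}=\{[x]_{\mathrm{AC}}\mid x\in X\}$; $\mathrm{size}([s]_{\mathrm{AC}})=\mathrm{size}(s)$ (well defined). Operations on $\mathbb{N}_{\mathrm{sb}}[X]$: $p+0=0+p=p$, and $[s]_{\mathrm{AC}}+[t]_{\mathrm{AC}}=[s\hat+t]_{\mathrm{AC}}$ for $s,t\neq\hat 0$; $p\times 0=0\times p=0$, $p\times1=1\times p=p$, and $[s]_{\mathrm{AC}}\times[t]_{\mathrm{AC}}=[s\hat\times t]_{\mathrm{AC}}$ for $s,t\notin\{\hat 0,\hat 1\}$. Polynomials. A monomial term is a term built from elements of $X$ using only $\hat\times$; a monomial is the class of a monomial term. The set $\mathrm{PT}(X)$ of polynomial terms is the smallest $U\subseteq \mathrm{ST}(X)$ with: (a) $\hat 0,\hat 1$ and all monomial terms are in $U$; (b) if $s,t\in U\setminus\{\hat 0\}$ then $s\hat+t\in U$; (c) if $s$ is a monomial term and $t\in U\setminus\{\hat 0,\hat 1\}$ then $s\hat\times t\in U$. Terms arising by (b) (resp. (c)) are sum (resp. product) polynomial terms. $\mathbb{N}_{\mathrm{rd}}[X]=\{[t]_{\mathrm{AC}}\mid t\in \mathrm{PT}(X)\}$, whose elements are called polynomials; classes of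 sum (product) polynomial terms are sum (product) polynomials. Facts making the next definition meaningful: every polynomial outside $X/\mathrm{AC}\cup\{0,1\}$ is exactly one of a sum polynomial or a product polynomial; each sum polynomial is $q_1+\dots+q_n$ with $n\ge2$ and each $q_i$ a product polynomial or in $X/\mathrm{AC}\cup\{1\}$, uniquely up to permutation; each product polynomial that is not a monomial is $m\times q'$ for a unique monomial $m$ and unique sum polynomial $q'$. Multiplication $\times_{\mathrm{rd}}$ on $\mathbb{N}_{\mathrm{rd}}[X]$, by induction on $\mathrm{size}(q)$: $q\times_{\mathrm{rd}}0=0\times_{\mathrm{rd}}q=0$, $q\times_{\mathrm{rd}}1=1\times_{\mathrm{rd}}q=q$; for $q,r\notin\{0,1\}$: if $q$ is a monomial, $q\times_{\mathrm{rd}}r=q\times r$; if $q$ is a sum polynomial, written as $q=q_1+\dots+q_n$ with $n\ge2$ and each $q_i$ a product polynomial or in $X/\mathrm{AC}\cup\{1\}$, $q\times_{\mathrm{rd}}r=q_1\times_{\mathrm{rd}}r+\dots+q_n\times_{\mathrm{rd}}r$; if $q=m\times q'$ with $m$ a monomial and $q'$ a sum polynomial, $q\times_{\mathrm{rd}}r=m\times(q'\times_{\mathrm{rd}}r)$. Id-reduced polynomials. A sum term is a simple term $s_1\hat+s_2$ with $s_1,s_2\in \mathrm{ST}(X)\setminus\{\hat 0\}$; a product term is a simple term $s_1\hat\times s_2$ with $s_1,s_2\in \mathrm{ST}(X)\setminus\{\hat0,\hat1\}$. Each sum term is, up to omitted parentheses, uniquely $t_1\hat+\cdots\hat+t_n$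 ($n\ge2$) with every $t_i$ a product term or in $X\cup\{\hat 1\}$ (its sum-product decomposition). $\mathrm{ST}_{\mathrm{id}}(X)$ is the smallest $U\subseteq \mathrm{ST}(X)$ with: (a) $\hat0,\hat1$ and all monomial terms are in $U$; (b) if $t$ is a sum term with sum-product decomposition $t_1\hat+\cdots\hat+t_n$, all $t_i\in U$, and $t_i\neq_{\mathrm{AC}}t_j$ for $i<j$, then $t\in U$; (c) if $s,t\in U\setminus\{\hat0,\hat1\}$ then $s\hat\times t\in U$. $\mathrm{PT}_{\mathrm{id}}(X)=\mathrm{PT}(X)\cap \mathrm{ST}_{\mathrm{id}}(X)$, and $\mathbb{B}_{\mathrm{id,rd}}[X]=\{[t]_{\mathrm{AC}}\mid t\in \mathrm{PT}_{\mathrm{id}}(X)\}\subseteq\mathbb{N}_{\mathrm{rd}}[X]$ is the set of id-reduced polynomials; it is closed under $\times_{\mathrm{rd}}$. Addition $+_{\mathrm{id}}$ on $\mathbb{B}_{\mathrm{id,rd}}[X]$: $q+_{\mathrm{id}}0=0+_{\mathrm{id}}q=q$. For $q,r\ne0$ write $q=q_1+\dots+q_k$ and $r=r_1+\dots+r_n$ ($k,n\ge1$) with the $q_i$ pairwise different, the $r_j$ pairwise different, each being $1$, a monomial, or an id-reduced product polynomial; then $q+_{\mathrm{id}}r=q_1+\dots+q_k+r_{i_1}+\dots+r_{i_\ell}$ where $\{i_1,\dots,i_\ell\}$ is the maximal subset of $\{1,\dots,n\}$ with $\{q_1,\dots,q_k\}\cap\{r_{i_1},\dots,r_{i_\ell}\}=\emptyset$.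 *)

theory Defs
  imports "HOL-Algebra.Ring"
begin

section \<open>Strong bimonoids\<close>

locale strong_bimonoid = abelian_monoid R + monoid R for R (structure) +
  assumes l_null: "x \<in> carrier R \<Longrightarrow> \<zero> \<otimes> x = \<zero>"
    and r_null: "x \<in> carrier R \<Longrightarrow> x \<otimes> \<zero> = \<zero>"

definition right_distributive :: "('a, 'm) ring_scheme \<Rightarrow> bool" where
  "right_distributive R \<longleftrightarrow>
     (\<forall>a\<in>carrier R. \<forall>b\<in>carrier R. \<forall>c\<in>carrier R.
        (a \<oplus>\<^bsub>R\<^esub> b) \<otimes>\<^bsub>R\<^esub> c = (a \<otimes>\<^bsub>R\<^esub> c) \<oplus>\<^bsub>R\<^esub> (b \<otimes>\<^bsub>R\<^esub> c))"

definition idempotent_addition :: "('a, 'm) ring_scheme \<Rightarrow> bool" where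
  "idempotent_addition R \<longleftrightarrow> (\<forall>b\<in>carrier R. b \<oplus>\<^bsub>R\<^esub> b = b)"


section \<open>Terms, simple terms and AC-equivalence\<close>

datatype (vars: 'x) trm =
    Var 'x
  | Zero
  | One
  | Plus "'x trm" "'x trm"
  | Times "'x trm" "'x trm"

fun subterms :: "'x trm \<Rightarrow> 'x trm set" where
  "subterms (Plus s t) = insert (Plus s t) (subterms s \<union> subterms t)"
| "subterms (Times s t) = insert (Times s t) (subterms s \<union> subterms t)"
| "subterms t = {t}"

definition simple :: "'x trm \<Rightarrow> bool" where
  "simple s \<longleftrightarrow> s = Zero \<or>
     (Zero \<notin> subterms s \<and>
      (\<forall>s'. Times One s' \<notin> subterms s \<and> Times s' One \<notin> subterms s))"

definition ST :: "'x set \<Rightarrow> 'x trm set" where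
  "ST X = {s. vars s \<subseteq> X \<and> simple s}"

inductive ac_step :: "'x trm \<Rightarrow> 'x trm \<Rightarrow> bool" where
  add_assoc: "ac_step (Plus a (Plus b c)) (Plus (Plus a b) c)"
| add_comm: "ac_step (Plus a b) (Plus b a)"
| mult_assoc: "ac_step (Times a (Times b c)) (Times (Times a b) c)"
| Plus_left: "ac_step s s' \<Longrightarrow> ac_step (Plus s t) (Plus s' t)"
| Plus_right: "ac_step t t' \<Longrightarrow> ac_step (Plus s t) (Plus s t')"
| Times_left: "ac_step s s' \<Longrightarrow> ac_step (Times s t) (Times s' t)"
| Times_right: "ac_step t t' \<Longrightarrow> ac_step (Times s t) (Times s t')"

definition ac_eq :: "'x trm \<Rightarrow> 'x trm \<Rightarrow> bool" where
  "ac_eq = equivclp ac_step"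

text \<open>
  AC-steps preserve the set of variables of a term, and (in both directions) simplicity.  So the
  classes of terms over a set \<open>X\<close> are the same whether AC-steps are taken among all terms
  or within \<^term>\<open>ST X\<close>.
\<close>

lemma ac_eq_vars: "ac_eq s t \<Longrightarrow> vars s = vars t"
proof -
  have step: "vars u = vars v" if "ac_step u v" for u v :: "'a trm"
    using that by induction auto
  assume "ac_eq s t"
  then show ?thesis unfolding ac_eq_def
    by (induction rule: equivclp_induct) (use step in blast)+
qed

lemma self_in_subterms [simp]: "t \<in> subterms t"
  by (cases t) auto

lemma simple_simps [simp]:
  "simple (Var x)" "simple Zero" "simple One"
  "simple (Plus s t) \<longleftrightarrow> simple s \<and> simple t \<and> s \<noteq> Zero \<and> t \<noteq> Zero"
  "simple (Times s t) \<longleftrightarrow> simple s \<and> simple t \<and> s \<noteq> Zero \<and> t \<noteq> Zero \<and> s \<noteq> One \<and> t \<noteq> One"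
proof -
  show "simple (Var x)" "simple Zero" "simple One"
    by (auto simp: simple_def)
  show "simple (Plus s t) \<longleftrightarrow> simple s \<and> simple t \<and> s \<noteq> Zero \<and> t \<noteq> Zero"
    by (auto simp: simple_def)
  show "simple (Times s t) \<longleftrightarrow> simple s \<and> simple t \<and> s \<noteq> Zero \<and> t \<noteq> Zero \<and> s \<noteq> One \<and> t \<noteq> One"
    by (auto simp: simple_def)
qed

lemma ac_step_consts:
  assumes "ac_step s t"
  shows "s \<noteq> Zero \<and> t \<noteq> Zero \<and> s \<noteq> One \<and> t \<noteq> One"
  using assms by cases auto

lemma ac_eq_simple: "ac_eq s t \<Longrightarrow> simple s \<longleftrightarrow> simple t"
proof -
  have step: "simple u \<longleftrightarrow> simple v" if "ac_step u v" for u v :: "'a trm"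
    using that by induction (auto dest: ac_step_consts)
  assume "ac_eq s t"
  then show ?thesis unfolding ac_eq_def
    by (induction rule: equivclp_induct) (use step in blast)+
qed

lemma ac_eq_consts:
  assumes "ac_eq s t"
  shows "s = Zero \<longleftrightarrow> t = Zero" "s = One \<longleftrightarrow> t = One"
proof -
  have "(s = Zero \<longleftrightarrow> t = Zero) \<and> (s = One \<longleftrightarrow> t = One)"
    using assms unfolding ac_eq_def
  proof (induction rule: equivclp_induct)
    case (step y z)
    then show ?case using ac_step_consts[of y z] ac_step_consts[of z y] by auto
  qed simp
  then show "s = Zero \<longleftrightarrow> t = Zero" "s = One \<longleftrightarrow> t = One" by auto
qed

lemma ac_eq_refl [simp]: "ac_eq s s"
  by (simp add: ac_eq_def)

lemma ac_eq_sym: "ac_eq s t \<Longrightarrow> ac_eq t s"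
  unfolding ac_eq_def by (rule equivclp_sym)

lemma ac_eq_trans: "ac_eq s t \<Longrightarrow> ac_eq t u \<Longrightarrow> ac_eq s u"
  unfolding ac_eq_def by (rule equivclp_trans)

lemma ac_eq_context:
  assumes "\<And>u v. ac_step u v \<Longrightarrow> ac_step (f u) (f v)" "ac_eq s t"
  shows "ac_eq (f s) (f t)"
  using assms(2) unfolding ac_eq_def
proof (induction rule: equivclp_induct)
  case (step y z)
  then have "equivclp ac_step (f y) (f z)"
    using assms(1) by (auto intro: r_into_equivclp converse_r_into_equivclp)
  with step.IH show ?case by (rule equivclp_trans)
qed simp

lemma ac_eq_Plus: "ac_eq s s' \<Longrightarrow> ac_eq t t' \<Longrightarrow> ac_eq (Plus s t) (Plus s' t')"
  using ac_eq_context[of "\<lambda>s. Plus s t"] ac_eq_context[of "Plus s'"]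
  by (meson ac_eq_trans Plus_left Plus_right)

lemma ac_eq_Times: "ac_eq s s' \<Longrightarrow> ac_eq t t' \<Longrightarrow> ac_eq (Times s t) (Times s' t')"
  using ac_eq_context[of "\<lambda>s. Times s t"] ac_eq_context[of "Times s'"]
  by (meson ac_eq_trans Times_left Times_right)


section \<open>The algebra of AC-classes of simple terms\<close>

text \<open>
  Elements of \<open>'x nsb\<close> are the AC-classes of simple terms over the whole type \<open>'x\<close>.  Those
  over a set \<open>X\<close> of variables are the classes \<open>ac_class s\<close> with \<^term>\<open>s \<in> ST X\<close>.
  The class \<open>ac_class s\<close> is meaningful only for simple \<open>s\<close>.
\<close>

quotient_type 'x nsb = "'x trm" / partial: "\<lambda>s t. simple s \<and> simple t \<and> ac_eq s t"
  morphisms rep_class ac_class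
proof (rule part_equivpI)
  show "\<exists>s::'x trm. simple s \<and> simple s \<and> ac_eq s s"
    by (rule exI[of _ Zero]) simp
  show "symp (\<lambda>s t :: 'x trm. simple s \<and> simple t \<and> ac_eq s t)"
    by (auto intro!: sympI ac_eq_sym)
  show "transp (\<lambda>s t :: 'x trm. simple s \<and> simple t \<and> ac_eq s t)"
    by (auto intro!: transpI intro: ac_eq_trans)
qed

instantiation nsb :: (type) "{comm_monoid_add, monoid_mult, mult_zero}"
begin

lift_definition zero_nsb :: "'a nsb" is Zero by simp

lift_definition one_nsb :: "'a nsb" is One by simp

lift_definition plus_nsb :: "'a nsb \<Rightarrow> 'a nsb \<Rightarrow> 'a nsb" is
  "\<lambda>s t. if s = Zero then t else if t = Zero then s else Plus s t"
  by (auto dest: ac_eq_consts intro: ac_eq_Plus)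

lift_definition times_nsb :: "'a nsb \<Rightarrow> 'a nsb \<Rightarrow> 'a nsb" is
  "\<lambda>s t. if s = Zero \<or> t = Zero then Zero
         else if s = One then t else if t = One then s else Times s t"
  by (auto dest: ac_eq_consts intro: ac_eq_Times)

instance
proof
  fix p q r :: "'a nsb"
  show "p + q + r = p + (q + r)"
    by transfer (auto intro: ac_eq_sym simp: ac_eq_def r_into_equivclp converse_r_into_equivclp add_assoc)
  show "p + q = q + p"
    by transfer (auto simp: ac_eq_def r_into_equivclp add_comm)
  show "0 + p = p"
    by transfer auto
  show "p * q * r = p * (q * r)"
    by transfer (auto simp: ac_eq_def converse_r_into_equivclp mult_assoc)
  show "1 * p = p"
    by transfer auto
  show "p * 1 = p"
    by transfer auto
  show "0 * p = 0"
    by transfer auto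
  show "p * 0 = 0"
    by transfer auto
qed

end


section \<open>Polynomials\<close>

inductive_set monomial_terms :: "'x set \<Rightarrow> 'x trm set" for X where
  Var: "x \<in> X \<Longrightarrow> Var x \<in> monomial_terms X"
| Times: "s \<in> monomial_terms X \<Longrightarrow> t \<in> monomial_terms X \<Longrightarrow> Times s t \<in> monomial_terms X"

inductive_set PT :: "'x set \<Rightarrow> 'x trm set" for X where
  Zero: "Zero \<in> PT X"
| One: "One \<in> PT X"
| monomial: "t \<in> monomial_terms X \<Longrightarrow> t \<in> PT X"
| sum: "s \<in> PT X \<Longrightarrow> s \<noteq> Zero \<Longrightarrow> t \<in> PT X \<Longrightarrow> t \<noteq> Zero \<Longrightarrow> Plus s t \<in> PT X"
| product: "s \<in> monomial_terms X \<Longrightarrow> t \<in> PT X \<Longrightarrow> t \<notin> {Zero, One} \<Longrightarrow> Times s t \<in> PT X"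

lemma monomial_terms_ST:
  "t \<in> monomial_terms X \<Longrightarrow> t \<in> ST X \<and> t \<noteq> Zero \<and> t \<noteq> One"
  by (induction rule: monomial_terms.induct) (auto simp: ST_def)

lemma PT_subset_ST: "PT X \<subseteq> ST X"
proof
  fix t assume "t \<in> PT X"
  then show "t \<in> ST X"
    by induction (auto simp: ST_def dest: monomial_terms_ST[unfolded ST_def])
qed

definition var_classes :: "'x set \<Rightarrow> 'x nsb set" where
  "var_classes X = (\<lambda>x. ac_class (Var x)) ` X"

definition monomials :: "'x set \<Rightarrow> 'x nsb set" where
  "monomials X = ac_class ` monomial_terms X"

definition N_rd :: "'x set \<Rightarrow> 'x nsb set" where
  "N_rd X = ac_class ` PT X"

definition sum_polys :: "'x set \<Rightarrow> 'x nsb set" where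
  "sum_polys X = {ac_class (Plus s t) | s t. s \<in> PT X - {Zero} \<and> t \<in> PT X - {Zero}}"

definition product_polys :: "'x set \<Rightarrow> 'x nsb set" where
  "product_polys X =
     {ac_class (Times s t) | s t. s \<in> monomial_terms X \<and> t \<in> PT X - {Zero, One}}"

text \<open>
  The recursion defining \<open>\<times>\<^sub>r\<^sub>d\<close> is given as its graph: \<open>rd_graph X q r p\<close> means that
  the defining clauses yield \<open>q \<times>\<^sub>r\<^sub>d r = p\<close>.  The recursive calls in the last two clauses
  are on left arguments of smaller size.
\<close>

inductive rd_graph :: "'x set \<Rightarrow> 'x nsb \<Rightarrow> 'x nsb \<Rightarrow> 'x nsb \<Rightarrow> bool" for X where
  zero_right: "q \<in> N_rd X \<Longrightarrow> rd_graph X q 0 0"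
| zero_left: "q \<in> N_rd X \<Longrightarrow> rd_graph X 0 q 0"
| one_right: "q \<in> N_rd X \<Longrightarrow> rd_graph X q 1 q"
| one_left: "q \<in> N_rd X \<Longrightarrow> rd_graph X 1 q q"
| monomial: "q \<in> monomials X \<Longrightarrow> r \<in> N_rd X - {0, 1} \<Longrightarrow> rd_graph X q r (q * r)"
| sum: "length qs \<ge> 2 \<Longrightarrow> set qs \<subseteq> product_polys X \<union> var_classes X \<union> {1} \<Longrightarrow>
    r \<in> N_rd X - {0, 1} \<Longrightarrow> length ps = length qs \<Longrightarrow>
    (\<And>i. i < length qs \<Longrightarrow> rd_graph X (qs ! i) r (ps ! i)) \<Longrightarrow>
    rd_graph X (sum_list qs) r (sum_list ps)"
| product: "m \<in> monomials X \<Longrightarrow> q' \<in> sum_polys X \<Longrightarrow> r \<in> N_rd X - {0, 1} \<Longrightarrow>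
    rd_graph X q' r p \<Longrightarrow> rd_graph X (m * q') r (m * p)"

definition rd_mult :: "'x set \<Rightarrow> 'x nsb \<Rightarrow> 'x nsb \<Rightarrow> 'x nsb" where
  "rd_mult X q r = (THE p. rd_graph X q r p)"


section \<open>Id-reduced polynomials\<close>

definition sum_terms :: "'x set \<Rightarrow> 'x trm set" where
  "sum_terms X = {Plus s t | s t. s \<in> ST X - {Zero} \<and> t \<in> ST X - {Zero}}"

definition product_terms :: "'x set \<Rightarrow> 'x trm set" where
  "product_terms X = {Times s t | s t. s \<in> ST X - {Zero, One} \<and> t \<in> ST X - {Zero, One}}"

text \<open>The sum-product decomposition of a sum term (see \<open>summands_sum_term\<close> below).\<close>

fun summands :: "'x trm \<Rightarrow> 'x trm list" where
  "summands (Plus s t) = summands s @ summands t"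
| "summands t = [t]"

lemma summands_nonempty: "summands t \<noteq> []"
  by (induction t) auto

lemma summands_ST:
  "t \<in> ST X - {Zero} \<Longrightarrow> set (summands t) \<subseteq> product_terms X \<union> Var ` X \<union> {One}"
  by (induction t) (auto simp: ST_def product_terms_def)

lemma summands_sum_term:
  assumes "t \<in> sum_terms X"
  shows "length (summands t) \<ge> 2"
    and "set (summands t) \<subseteq> product_terms X \<union> Var ` X \<union> {One}"
proof -
  obtain u v where t: "t = Plus u v" "u \<in> ST X - {Zero}" "v \<in> ST X - {Zero}"
    using assms by (auto simp: sum_terms_def)
  have "length (summands u) \<ge> 1" "length (summands v) \<ge> 1"
    using summands_nonempty[of u] summands_nonempty[of v] by (simp_all add: Suc_le_eq)
  then show "length (summands t) \<ge> 2"
    using t(1) by simp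
  show "set (summands t) \<subseteq> product_terms X \<union> Var ` X \<union> {One}"
    using t(1) summands_ST[OF t(2)] summands_ST[OF t(3)] by simp
qed

inductive_set ST_id :: "'x set \<Rightarrow> 'x trm set" for X where
  Zero: "Zero \<in> ST_id X"
| One: "One \<in> ST_id X"
| monomial: "t \<in> monomial_terms X \<Longrightarrow> t \<in> ST_id X"
| sum: "t \<in> sum_terms X \<Longrightarrow> (\<And>u. u \<in> set (summands t) \<Longrightarrow> u \<in> ST_id X) \<Longrightarrow>
    sorted_wrt (\<lambda>u v. \<not> ac_eq u v) (summands t) \<Longrightarrow> t \<in> ST_id X"
| product: "s \<in> ST_id X \<Longrightarrow> s \<notin> {Zero, One} \<Longrightarrow> t \<in> ST_id X \<Longrightarrow> t \<notin> {Zero, One} \<Longrightarrow>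
    Times s t \<in> ST_id X"

lemma ST_id_subset_ST: "ST_id X \<subseteq> ST X"
proof
  fix t assume "t \<in> ST_id X"
  then show "t \<in> ST X"
    by induction (auto simp: ST_def sum_terms_def dest: monomial_terms_ST[unfolded ST_def])
qed

definition PT_id :: "'x set \<Rightarrow> 'x trm set" where
  "PT_id X = PT X \<inter> ST_id X"

definition B_id_rd_set :: "'x set \<Rightarrow> 'x nsb set" where
  "B_id_rd_set X = ac_class ` PT_id X"

definition id_decomposition :: "'x set \<Rightarrow> 'x nsb \<Rightarrow> 'x nsb list \<Rightarrow> bool" where
  "id_decomposition X q qs \<longleftrightarrow>
     q = sum_list qs \<and> length qs \<ge> 1 \<and> distinct qs \<and>
     set qs \<subseteq> {1} \<union> monomials X \<union> (product_polys X \<inter> B_id_rd_set X)"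

text \<open>
  The indices \<open>j\<close> kept by the filter form the largest set of indices of \<open>rs\<close> whose entries
  avoid the entries of \<open>qs\<close>.
\<close>

definition id_add :: "'x set \<Rightarrow> 'x nsb \<Rightarrow> 'x nsb \<Rightarrow> 'x nsb" where
  "id_add X q r =
     (if q = 0 then r else if r = 0 then q
      else THE p. \<exists>qs rs. id_decomposition X q qs \<and> id_decomposition X r rs \<and>
        p = sum_list qs + sum_list (filter (\<lambda>r'. r' \<notin> set qs) rs))"

definition B_id_rd :: "'x set \<Rightarrow> 'x nsb ring" where
  "B_id_rd X =
     \<lparr>carrier = B_id_rd_set X, mult = rd_mult X, one = 1, zero = 0, add = id_add X\<rparr>"

end

theory Submission
  imports Defs "HOL-Library.Multiset"
begin

section \<open>A multiset model of polynomials\<close>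

text \<open>
  A polynomial is a finite multiset of summands, and a summand is \<open>1\<close>, a monomial or a monomial
  times a sum polynomial.  Taken as a nested datatype (\<open>item\<close>), this description gives a
  model of \<open>\<nat>\<^sub>r\<^sub>d[X]\<close> in which the axioms can be checked without any reference to AC-classes.

  In the model, addition of polynomials is the sum of multisets, and \<open>\<times>\<^sub>r\<^sub>d\<close> becomes an operation
  \<open>\<star>\<close> defined by structural recursion.  It distributes over sums from the right by definition, and
  it is associative since prepending a word commutes with \<open>\<star>\<close> (\<open>times_prepend\<close>,
  \<open>times_items_assoc\<close>).  A right-distributive algebra of this kind admits an interpretation
  \<open>nf\<close> of all terms that is invariant under AC-steps.  Reading multisets of items as expressions
  in \<open>'x nsb\<close> (\<open>embed\<close>) is inverse to it on polynomials.  So \<open>embed\<close> maps the proper multisets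
  bijectively onto \<open>\<nat>\<^sub>r\<^sub>d[X]\<close> and those that are hereditarily free of repetitions onto
  \<open>B\<^sub>i\<^sub>d\<^sub>,\<^sub>r\<^sub>d[X]\<close> (\<open>N_rd_embed\<close>, \<open>B_id_rd_embed\<close>).  It turns \<open>\<star>\<close> into \<open>\<times>\<^sub>r\<^sub>d\<close> and the union of
  multisets into \<open>+\<^sub>i\<^sub>d\<close> (\<open>rd_mult_embed\<close>, \<open>id_add_embed\<close>); along the way these lemmas show that
  the two operations are well defined.

  All laws are then immediate except that id-reduced polynomials are closed under \<open>\<star>\<close>.  Since
  \<open>M \<star> C\<close> is the sum of the products \<open>i \<star> C\<close> over the summands \<open>i\<close> of \<open>M\<close>, the point is that
  for different \<open>i\<close> and \<open>j\<close> these products have no summand in common (\<open>times_item_overlap\<close>).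
  This is a form of right cancellation, proved by induction on \<open>i\<close> and a comparison of sizes.  Right
  distributivity over \<open>+\<^sub>i\<^sub>d\<close> follows, because on multisets without repetitions equality is equality
  of the sets of summands.
\<close>

text \<open>
An item stands for one summand of a polynomial: \<open>Item [] {#}\<close> for \<open>1\<close>, \<open>Item w {#}\<close> for the
monomial with the word \<open>w\<close>, and \<open>Item w P\<close> for the product of that monomial and the sum
polynomial \<open>P\<close>.
\<close>

datatype 'x item = Item "'x list" "'x item multiset"

text \<open>
Left multiplication by a monomial.  A single summand absorbs the word into its own; a sum with at
least two summands becomes the tail of a new item, since no left distributivity holds.
\<close>

definition prepend :: "'x list \<Rightarrow> 'x item multiset \<Rightarrow> 'x item multiset" where
  "prepend w R =
     (if w = [] \<or> R = {#} then R
      else if size R = 1 then image_mset (case_item (\<lambda>v Q. Item (w @ v) Q)) R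
      else {#Item w R#})"

text \<open>
The recursion of \<open>\<times>\<^sub>r\<^sub>d\<close>, with the clause for sums pushed into the tail of an item.
An empty tail stands for the factor \<open>1\<close>.
\<close>

primrec times_item :: "'x item \<Rightarrow> 'x item multiset \<Rightarrow> 'x item multiset" where
  "times_item (Item w P) R =
     prepend w (if P = {#} then R else (\<Sum>f\<in>#image_mset times_item P. f R))"

definition times_items :: "'x item multiset \<Rightarrow> 'x item multiset \<Rightarrow> 'x item multiset"
    (infixl "\<star>" 70) where
  "M \<star> R = (\<Sum>i\<in>#M. times_item i R)"

lemma prepend_simps [simp]:
  "prepend [] R = R"
  "prepend w {#} = {#}"
  "prepend w {#Item v Q#} = {#Item (w @ v) Q#}"
  by (auto simp: prepend_def)

lemma prepend_sum: "w \<noteq> [] \<Longrightarrow> size R \<ge> 2 \<Longrightarrow> prepend w R = {#Item w R#}"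
  by (auto simp: prepend_def)

lemma multiset_size_cases [case_names empty item many]:
  fixes R :: "'x item multiset"
  obtains "R = {#}" | v Q where "R = {#Item v Q#}" | "size R \<ge> 2"
proof -
  consider "size R = 0" | "size R = Suc 0" | "size R \<ge> 2" by linarith
  then show thesis
    using that by cases (auto dest!: size_1_singleton_mset[unfolded One_nat_def] intro: item.exhaust,
        metis item.exhaust)
qed

lemma times_item_Item [simp]:
  "times_item (Item w P) R = prepend w (if P = {#} then R else P \<star> R)"
  by (simp add: times_items_def image_mset.compositionality comp_def)

declare times_item.simps [simp del]

lemma times_items_simps [simp]:
  "{#} \<star> R = {#}"
  "{#i#} \<star> R = times_item i R"
  "(M + N) \<star> R = M \<star> R + N \<star> R"
  by (simp_all add: times_items_def)

lemma set_times_items: "set_mset (M \<star> R) = (\<Union>i\<in>set_mset M. set_mset (times_item i R))"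
  by (simp add: times_items_def)

lemma prepend_prepend: "prepend w (prepend v R) = prepend (w @ v) R"
  by (cases R rule: multiset_size_cases; cases "w = []"; cases "v = []") (auto simp: prepend_sum)

text \<open>
The case of associativity in which the leftmost factor is a monomial; right distributivity reduces
the general case to it.
\<close>

lemma times_prepend: "prepend w R \<star> C = prepend w (R \<star> C)"
  by (cases R rule: multiset_size_cases; cases "w = []") (auto simp: prepend_sum prepend_prepend)

lemma times_item_assoc: "times_item i B \<star> C = times_item i (B \<star> C)"
proof (induction i)
  case (Item w P)
  have "(P \<star> B) \<star> C = P \<star> (B \<star> C)"
    using Item
  proof (induction P)
    case (add i P)
    then show ?case by (simp add: times_items_def)
  qed simp
  then show ?case by (simp add: times_prepend)
qed

lemma times_items_assoc: "(A \<star> B) \<star> C = A \<star> (B \<star> C)"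
proof (induction A)
  case (add i A)
  then show ?case using times_item_assoc[of i B C] by (simp add: times_items_def)
qed simp

lemma times_zero_right: "M \<star> {#} = {#}"
proof -
  have item: "times_item i {#} = {#}" for i :: "'a item"
  proof (induction i)
    case (Item w P)
    then have "P \<star> {#} = {#}" by (simp add: times_items_def)
    then show ?case by simp
  qed
  show ?thesis by (simp add: times_items_def item)
qed

abbreviation one_items :: "'x item multiset" where
  "one_items \<equiv> {#Item [] {#}#}"

text \<open>
Proper items are those that name a summand uniquely: a tail must be a genuine sum, and the word in
front of it must not be empty (otherwise the tail itself would consist of summands of the outer
sum).
\<close>

inductive proper :: "'x set \<Rightarrow> 'x item \<Rightarrow> bool" for X where
  "set w \<subseteq> X \<Longrightarrow> P = {#} \<or> w \<noteq> [] \<and> size P \<ge> 2 \<Longrightarrow> \<forall>i\<in>#P. proper X i \<Longrightarrow> proper X (Item w P)"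

lemma proper_Item [simp]:
  "proper X (Item w P) \<longleftrightarrow>
     set w \<subseteq> X \<and> (P = {#} \<or> w \<noteq> [] \<and> size P \<ge> 2) \<and> (\<forall>i\<in>#P. proper X i)"
  by (subst proper.simps) auto

definition polys :: "'x set \<Rightarrow> 'x item multiset set" where
  "polys X = {M. \<forall>i\<in>#M. proper X i}"

lemma polys_simps [simp]:
  "{#} \<in> polys X" "add_mset i M \<in> polys X \<longleftrightarrow> proper X i \<and> M \<in> polys X"
  "M + N \<in> polys X \<longleftrightarrow> M \<in> polys X \<and> N \<in> polys X"
  by (auto simp: polys_def)

lemma prepend_polys: "set w \<subseteq> X \<Longrightarrow> R \<in> polys X \<Longrightarrow> prepend w R \<in> polys X"
  by (cases R rule: multiset_size_cases; cases "w = []") (auto simp: prepend_sum polys_def)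

lemma times_item_polys: "proper X i \<Longrightarrow> R \<in> polys X \<Longrightarrow> times_item i R \<in> polys X"
proof (induction i)
  case (Item w P)
  then have "P \<star> R \<in> polys X" by (auto simp: set_times_items polys_def)
  with Item.prems show ?case by (simp add: prepend_polys)
qed

lemma times_items_polys: "M \<in> polys X \<Longrightarrow> R \<in> polys X \<Longrightarrow> M \<star> R \<in> polys X"
  by (induction M) (simp_all add: times_items_def times_item_polys)

text \<open>
Multiplying by \<open>1\<close> on the right puts each proper tail behind its word again.  An improper
item need not survive: a one-element tail would be merged with the word.
\<close>

lemma times_item_one: "proper X i \<Longrightarrow> times_item i one_items = {#i#}"
proof (induction i)
  case (Item w P)
  then have "(\<Sum>i\<in>#P. times_item i one_items) = (\<Sum>i\<in>#P. {#i#})"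
    by (intro arg_cong[where f = sum_mset] image_mset_cong) auto
  then have "P \<star> one_items = P" by (simp add: times_items_def)
  with Item.prems show ?case by (auto simp: prepend_sum)
qed

lemma times_items_one: "M \<in> polys X \<Longrightarrow> M \<star> one_items = M"
  by (induction M) (simp_all add: times_items_def times_item_one[of X])

section \<open>Right cancellation\<close>

inductive reduced :: "'x item \<Rightarrow> bool" where
  "\<forall>i. count P i \<le> 1 \<Longrightarrow> \<forall>i\<in>#P. reduced i \<Longrightarrow> reduced (Item w P)"

lemma reduced_Item [simp]:
  "reduced (Item w P) \<longleftrightarrow> (\<forall>i. count P i \<le> 1) \<and> (\<forall>i\<in>#P. reduced i)"
  by (subst reduced.simps) auto

definition id_polys :: "'x set \<Rightarrow> 'x item multiset set" where
  "id_polys X = {M \<in> polys X. (\<forall>i. count M i \<le> 1) \<and> (\<forall>i\<in>#M. reduced i)}"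

text \<open>
A measure under which multiplication on the left by an item never shrinks a polynomial
(\<open>total_weight_times_item\<close>), while a left factor with at least two summands makes a nonzero polynomial strictly heavier.
\<close>

primrec weight :: "'x item \<Rightarrow> nat" where
  "weight (Item w P) = Suc (length w + (\<Sum>n\<in>#image_mset weight P. n))"

definition total_weight :: "'x item multiset \<Rightarrow> nat" where
  "total_weight M = (\<Sum>i\<in>#M. weight i)"

lemma weight_Item [simp]: "weight (Item w P) = Suc (length w + total_weight P)"
  by (simp add: total_weight_def)

declare weight.simps [simp del]

lemma total_weight_simps [simp]:
  "total_weight {#} = 0" "total_weight (add_mset i M) = weight i + total_weight M"
  "total_weight (M + N) = total_weight M + total_weight N"
  by (simp_all add: total_weight_def)

lemma weight_le_total: "i \<in># M \<Longrightarrow> weight i \<le> total_weight M"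
  by (auto dest: multi_member_split)

lemma total_weight_prepend: "total_weight R \<le> total_weight (prepend w R)"
  by (cases R rule: multiset_size_cases; cases "w = []") (auto simp: prepend_sum)

lemma total_weight_times_item: "total_weight R \<le> total_weight (times_item i R)"
proof (induction i)
  case (Item w P)
  have "total_weight R \<le> total_weight (P \<star> R)" if P: "P \<noteq> {#}"
  proof -
    obtain i P' where "P = add_mset i P'" using P by (cases P) auto
    then show ?thesis using Item[of i] by (simp add: times_items_def)
  qed
  then show ?case using total_weight_prepend[of _ w] order_trans by auto
qed

lemma total_weight_times: "size M * total_weight R \<le> total_weight (M \<star> R)"
proof (induction M)
  case (add i M)
  then show ?case using total_weight_times_item[of R i] by (simp add: times_items_def)
qed simp

lemma size_times:
  assumes "R \<noteq> {#}" shows "size M \<le> size (M \<star> R)"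
proof (induction M)
  case (add i M)
  have "total_weight R \<noteq> 0"
  proof -
    obtain i R' where "R = add_mset i R'" using assms by (cases R) auto
    then show ?thesis by (cases i) simp
  qed
  then have "times_item i R \<noteq> {#}"
    using total_weight_times_item[of R i] by auto
  then have "size (times_item i R) \<ge> 1" by (simp add: Suc_le_eq nonempty_has_size)
  with add show ?case by (simp add: times_items_def)
qed simp


lemma multiset_eqI_of_set:
  assumes "\<forall>i. count M i \<le> 1" "\<forall>i. count N i \<le> 1" "set_mset M = set_mset N"
  shows "M = N"
proof (rule multiset_eqI)
  fix x
  have "count M x = 0 \<longleftrightarrow> count N x = 0" using assms(3) by (metis count_eq_zero_iff)
  moreover have "count M x \<le> 1" "count N x \<le> 1" using assms by auto
  ultimately show "count M x = count N x" by linarith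
qed

lemma times_item_nonempty: "R \<noteq> {#} \<Longrightarrow> times_item i R \<noteq> {#}"
  using size_times[of R "{#i#}"] by auto

text \<open>
If products of distinct summands with \<open>C\<close> never overlap, then the summands of \<open>P\<close> can be read off
from \<open>P \<star> C\<close>: any summand \<open>z\<close> of \<open>i \<star> C\<close> reveals \<open>i\<close>.
\<close>

lemma times_cancel_right:
  assumes nonempty: "C \<noteq> {#}"
    and once: "\<forall>i. count P i \<le> 1" "\<forall>i. count P' i \<le> 1"
    and eq: "P \<star> C = P' \<star> C"
    and overlap: "\<And>i j z. i \<in># P \<Longrightarrow> j \<in># P' \<Longrightarrow> z \<in># times_item i C \<Longrightarrow> z \<in># times_item j C \<Longrightarrow> i = j"
  shows "P = P'"
proof (rule multiset_eqI_of_set[OF once])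
  have "i \<in># P'" if "i \<in># P" for i
  proof -
    obtain z where z: "z \<in># times_item i C" using times_item_nonempty[OF nonempty] by blast
    then have "z \<in># P' \<star> C" using that unfolding eq[symmetric] set_times_items by blast
    then show ?thesis using overlap[OF that _ z] by (auto simp: set_times_items)
  qed
  moreover have "j \<in># P" if "j \<in># P'" for j
  proof -
    obtain z where z: "z \<in># times_item j C" using times_item_nonempty[OF nonempty] by blast
    then have "z \<in># P \<star> C" using that unfolding eq set_times_items by blast
    then show ?thesis using overlap[OF _ that _ z] by (auto simp: set_times_items)
  qed
  ultimately show "set_mset P = set_mset P'" by blast
qed

text \<open>
This is what keeps id-reduced polynomials closed under multiplication.  A product of a summand and
\<open>C\<close> is a single item unless the summand is \<open>1\<close>, so two products overlap only by equality of
items.  If both summands have a tail, the induction hypothesis applies to the items of the tails,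
which are then equal by cancellation.  If the summands differ in kind, an equality would identify
an expression built around \<open>C\<close> with \<open>C\<close> itself or a part of it, which is lighter.
\<close>

lemma times_item_overlap:
  assumes "C \<noteq> {#}"
  shows "proper X i \<Longrightarrow> reduced i \<Longrightarrow> proper X j \<Longrightarrow> reduced j \<Longrightarrow>
    z \<in># times_item i C \<Longrightarrow> z \<in># times_item j C \<Longrightarrow> i = j"
proof (induction i arbitrary: j z)
  case (Item w P)
  obtain w' P' where j: "j = Item w' P'" by (cases j)
  have heavier: "total_weight C < total_weight (N \<star> C)" "size (N \<star> C) \<ge> 2" if "size N \<ge> 2" for N
  proof -
    obtain i C' where "C = add_mset i C'" using assms by (cases C) auto
    then have "0 < total_weight C" by (cases i) simp
    then have "total_weight C < 2 * total_weight C" by simp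
    also have "2 * total_weight C \<le> size N * total_weight C" using that by (rule mult_le_mono1)
    also have "\<dots> \<le> total_weight (N \<star> C)" by (rule total_weight_times)
    finally show "total_weight C < total_weight (N \<star> C)" .
    show "size (N \<star> C) \<ge> 2" using size_times[OF assms, of N] that by linarith
  qed
  have cancel: "P = P'" if "P \<star> C = P' \<star> C"
  proof (rule times_cancel_right[OF assms _ _ that])
    show "\<forall>i. count P i \<le> 1" "\<forall>i. count P' i \<le> 1" using Item.prems j by simp_all
    show "i = j" if "i \<in># P" "j \<in># P'" "z \<in># times_item i C" "z \<in># times_item j C" for i j z
      using Item.IH[OF that(1) _ _ _ _ that(3,4)] that(1,2) Item.prems j by simp
  qed
  show ?case
  proof (cases C rule: multiset_size_cases)
    case empty
    with assms show ?thesis by simp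
  next
    case (item v Q)
    \<comment> \<open>The product is a single item: the words are joined, or a sum becomes the tail.\<close>
    have form: "times_item (Item u N) C = {#if N = {#} then Item (u @ v) Q else Item u (N \<star> C)#}"
      if "proper X (Item u N)" for u N
      using that heavier(2)[of N] item by (auto simp: prepend_sum)
    have "N \<star> C \<noteq> Q" if "proper X (Item u N)" "N \<noteq> {#}" for u N
      using that heavier(1)[of N] item by auto
    then show ?thesis
      using Item.prems cancel unfolding j form[OF Item.prems(1)] form[OF Item.prems(3)[unfolded j]]
      by (auto split: if_splits)
  next
    case many
    \<comment> \<open>For \<open>u = []\<close> the item is \<open>1\<close>, and only then the summands of \<open>C\<close> surface.\<close>
    have form: "times_item (Item u N) C =
        (if u = [] then C else {#Item u (if N = {#} then C else N \<star> C)#})"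
      if "proper X (Item u N)" for u N
      using that heavier(2)[of N] many by (auto simp: prepend_sum)
    have ne: "N \<star> C \<noteq> C" if "proper X (Item u N)" "N \<noteq> {#}" for u N
      using that heavier(1)[of N] by auto
    have outside: "Item u (if N = {#} then C else N \<star> C) \<notin># C" if "proper X (Item u N)" for u N
    proof
      assume "Item u (if N = {#} then C else N \<star> C) \<in># C"
      then have "weight (Item u (if N = {#} then C else N \<star> C)) \<le> total_weight C"
        by (rule weight_le_total)
      then show False using that heavier(1)[of N] by (auto split: if_splits)
    qed
    show ?thesis
    proof (cases "w = [] \<or> w' = []")
      case True
      then show ?thesis
        using Item.prems outside[OF Item.prems(1)] outside[OF Item.prems(3)[unfolded j]]
        unfolding j form[OF Item.prems(1)] form[OF Item.prems(3)[unfolded j]]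
        by (cases "w = []"; cases "w' = []") simp_all
    next
      case False
      then have "w = w'" "(if P = {#} then C else P \<star> C) = (if P' = {#} then C else P' \<star> C)"
        using Item.prems unfolding j form[OF Item.prems(1)] form[OF Item.prems(3)[unfolded j]]
        by simp_all
      then show ?thesis
        using cancel ne[OF Item.prems(1)] ne[OF Item.prems(3)[unfolded j]] j by metis
    qed
  qed
qed

lemma prepend_id_polys: "set w \<subseteq> X \<Longrightarrow> R \<in> id_polys X \<Longrightarrow> prepend w R \<in> id_polys X"
  using prepend_polys[of w X R]
  by (cases R rule: multiset_size_cases; cases "w = []") (auto simp: prepend_sum id_polys_def)

lemma id_polys_add:
  "add_mset i M \<in> id_polys X \<longleftrightarrow> i \<notin># M \<and> proper X i \<and> reduced i \<and> M \<in> id_polys X"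
  unfolding id_polys_def by (auto simp: le_Suc_eq not_in_iff) 

lemma id_polys_plus:
  "A \<in> id_polys X \<Longrightarrow> B \<in> id_polys X \<Longrightarrow> set_mset A \<inter> set_mset B = {} \<Longrightarrow> A + B \<in> id_polys X"
  by (induction A) (auto simp: id_polys_add)

lemma empty_id_polys [simp]: "{#} \<in> id_polys X"
  by (simp add: id_polys_def)

text \<open>
Absence of overlaps is what keeps multiplicities at one when the products of the summands are
added up.
\<close>

lemma times_id_polysI:
  assumes "\<And>i. i \<in># M \<Longrightarrow> times_item i C \<in> id_polys X" "M \<in> id_polys X"
  shows "M \<star> C \<in> id_polys X"
proof (cases "C = {#}")
  case False
  show ?thesis using assms
  proof (induction M)
    case (add i M)
    have "set_mset (times_item i C) \<inter> set_mset (M \<star> C) = {}"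
    proof (rule ccontr)
      assume "\<not> ?thesis"
      then obtain z j where "z \<in># times_item i C" "j \<in># M" "z \<in># times_item j C"
        by (auto simp: set_times_items)
      moreover have "proper X j" "reduced j" "proper X i" "reduced i" "i \<notin># M"
        using add.prems(2) \<open>j \<in># M\<close> by (auto simp: id_polys_add) (auto simp: id_polys_def polys_def)
      ultimately show False using times_item_overlap[OF False] by metis
    qed
    moreover have "times_item i C \<in> id_polys X" using add.prems(1) by simp
    moreover have "M \<star> C \<in> id_polys X"
      using add.IH add.prems by (auto simp: id_polys_add)
    ultimately show ?case
      using id_polys_plus[of "times_item i C" X "M \<star> C"] by (simp add: times_items_def)
  qed simp
qed (simp add: times_zero_right)

lemma times_item_id_polys:
  assumes "C \<in> id_polys X"
  shows "proper X i \<Longrightarrow> reduced i \<Longrightarrow> times_item i C \<in> id_polys X"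
proof (induction i)
  case (Item w P)
  have "P \<star> C \<in> id_polys X"
  proof (rule times_id_polysI)
    show "P \<in> id_polys X" using Item.prems by (auto simp: id_polys_def polys_def)
    show "times_item i C \<in> id_polys X" if "i \<in># P" for i
      using Item.IH[OF that] Item.prems that by auto
  qed
  then show ?case using Item.prems assms by (simp add: prepend_id_polys)
qed

lemma times_id_polys: "M \<in> id_polys X \<Longrightarrow> C \<in> id_polys X \<Longrightarrow> M \<star> C \<in> id_polys X"
  by (rule times_id_polysI, rule times_item_id_polys) (auto simp: id_polys_def polys_def)

lemma union_id_polys: "A \<in> id_polys X \<Longrightarrow> B \<in> id_polys X \<Longrightarrow> A \<union># B \<in> id_polys X"
  by (auto simp: id_polys_def polys_def)

text \<open>
Right distributivity for the idempotent addition.  As both sides are id-reduced, they are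
determined by their sets of summands, where the claim is distributivity over unions.
\<close>

lemma union_times_id:
  assumes "A \<in> id_polys X" "B \<in> id_polys X" "C \<in> id_polys X"
  shows "(A \<union># B) \<star> C = (A \<star> C) \<union># (B \<star> C)"
proof (rule multiset_eqI_of_set)
  have "(A \<union># B) \<star> C \<in> id_polys X" "(A \<star> C) \<union># (B \<star> C) \<in> id_polys X"
    using assms by (simp_all add: times_id_polys union_id_polys)
  then show "\<forall>i. count ((A \<union># B) \<star> C) i \<le> 1" "\<forall>i. count ((A \<star> C) \<union># (B \<star> C)) i \<le> 1"
    unfolding id_polys_def by blast+
qed (auto simp: set_times_items)


section \<open>Normal forms of terms and of classes\<close>

text \<open>
All terms are interpreted, not just polynomial ones: the model satisfies associativity and
commutativity of addition and associativity of multiplication everywhere, so invariance under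
AC-steps comes for free.
\<close>

fun nf :: "'x trm \<Rightarrow> 'x item multiset" where
  "nf (Var x) = {#Item [x] {#}#}"
| "nf Zero = {#}"
| "nf One = one_items"
| "nf (Plus s t) = nf s + nf t"
| "nf (Times s t) = nf s \<star> nf t"

lemma nf_ac_eq: "ac_eq s t \<Longrightarrow> nf s = nf t"
proof -
  have step: "nf u = nf v" if "ac_step u v" for u v :: "'a trm"
    using that by induction (simp_all add: times_items_assoc)
  assume "ac_eq s t"
  then show ?thesis unfolding ac_eq_def
    by (induction rule: equivclp_induct) (use step in force)+
qed

lemma nf_polys: "vars t \<subseteq> X \<Longrightarrow> nf t \<in> polys X"
  by (induction t) (auto simp: times_items_polys)

lift_definition nf_class :: "'x nsb \<Rightarrow> 'x item multiset" is nf
  by (simp add: nf_ac_eq)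

lemma nf_class_ac_class: "simple t \<Longrightarrow> nf_class (ac_class t) = nf t"
  by (simp add: nf_class.abs_eq)

lemma ac_class_eqD: "ac_class s = ac_class t \<Longrightarrow> simple s \<Longrightarrow> simple t \<Longrightarrow> ac_eq s t"
  using Quotient_rel[OF Quotient_nsb, of s t] by auto

lemma ac_class_consts: "ac_class Zero = 0" "ac_class One = 1"
  by (simp_all add: zero_nsb_def one_nsb_def)

lemma ac_class_Plus:
  "simple s \<Longrightarrow> simple t \<Longrightarrow> s \<noteq> Zero \<Longrightarrow> t \<noteq> Zero \<Longrightarrow>
    ac_class (Plus s t) = ac_class s + ac_class t"
  by (simp add: plus_nsb.abs_eq)

lemma ac_class_Times:
  "simple s \<Longrightarrow> simple t \<Longrightarrow> s \<notin> {Zero, One} \<Longrightarrow> t \<notin> {Zero, One} \<Longrightarrow>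
    ac_class (Times s t) = ac_class s * ac_class t"
  by (simp add: times_nsb.abs_eq)

lemma nf_class_zero [simp]: "nf_class 0 = {#}"
  by transfer simp

lemma nf_class_one [simp]: "nf_class 1 = one_items"
  by transfer simp

lemma nf_class_plus [simp]: "nf_class (p + q) = nf_class p + nf_class q"
  by transfer auto

lemma nf_class_times [simp]: "nf_class (p * q) = nf_class p \<star> nf_class q"
  by transfer (auto simp: times_zero_right times_items_one[OF nf_polys[OF subset_UNIV]])

lemma nf_class_sum_list: "nf_class (sum_list qs) = sum_list (map nf_class qs)"
  by (induction qs) simp_all

definition word_class :: "'x list \<Rightarrow> 'x nsb" where
  "word_class w = prod_list (map (\<lambda>x. ac_class (Var x)) w)"

lemma word_class_simps [simp]:
  "word_class [] = 1" "word_class (v @ w) = word_class v * word_class w"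
  "word_class (x # w) = ac_class (Var x) * word_class w"
  by (simp_all add: word_class_def)

lemma nf_class_word_class [simp]: "nf_class (word_class w) = {#Item w {#}#}"
  by (induction w) (simp_all add: nf_class_ac_class)

text \<open>
The inverse of the normal form: reading a multiset of items as an expression in \<open>'x nsb\<close>.
\<close>

primrec embed_item :: "'x item \<Rightarrow> 'x nsb" where
  "embed_item (Item w P) =
     word_class w * (if P = {#} then 1 else (\<Sum>p\<in>#image_mset embed_item P. p))"

definition embed :: "'x item multiset \<Rightarrow> 'x nsb" where
  "embed M = (\<Sum>i\<in>#M. embed_item i)"

lemma embed_item_Item [simp]:
  "embed_item (Item w P) = word_class w * (if P = {#} then 1 else embed P)"
  by (simp add: embed_def)

declare embed_item.simps [simp del]

lemma embed_simps [simp]: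
  "embed {#} = 0" "embed (add_mset i M) = embed_item i + embed M"
  "embed (M + N) = embed M + embed N"
  by (simp_all add: embed_def)

lemma embed_sum_list: "embed (sum_list Ms) = sum_list (map embed Ms)"
  by (induction Ms) simp_all

lemma embed_mset: "embed (mset is) = sum_list (map embed_item is)"
  by (induction "is") simp_all

text \<open>
Evaluating an item and normalizing the result gives the item back; properness ensures that
prepending the word leaves the tail in place.
\<close>

lemma nf_embed_item: "proper X i \<Longrightarrow> nf_class (embed_item i) = {#i#}"
proof (induction i)
  case (Item w P)
  have "nf_class (embed N) = N" if "set_mset N \<subseteq> set_mset P" for N
    using that Item by (induction N) auto
  then have "nf_class (embed P) = P" by blast
  then show ?case using Item.prems by (auto simp: prepend_sum)
qed

lemma nf_embed: "M \<in> polys X \<Longrightarrow> nf_class (embed M) = M"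
  by (induction M) (auto simp: nf_embed_item)

lemma embed_inj: "M \<in> polys X \<Longrightarrow> N \<in> polys X \<Longrightarrow> embed M = embed N \<longleftrightarrow> M = N"
  by (metis nf_embed)

lemma embed_item_inj: "proper X i \<Longrightarrow> proper X j \<Longrightarrow> embed_item i = embed_item j \<longleftrightarrow> i = j"
  by (metis nf_embed_item single_eq_single)

lemma embed_prepend: "embed (prepend w R) = word_class w * embed R"
  by (cases R rule: multiset_size_cases; cases "w = []") (auto simp: prepend_sum mult.assoc)

lemma monomial_term_word:
  "t \<in> monomial_terms X \<Longrightarrow>
    \<exists>w. w \<noteq> [] \<and> set w \<subseteq> X \<and> nf t = {#Item w {#}#} \<and> ac_class t = word_class w"
proof (induction rule: monomial_terms.induct)
  case (Var x)
  then show ?case by (intro exI[of _ "[x]"]) simp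
next
  case (Times s t)
  then obtain v w where vw: "v \<noteq> []" "set v \<subseteq> X" "nf s = {#Item v {#}#}" "ac_class s = word_class v"
    "w \<noteq> []" "set w \<subseteq> X" "nf t = {#Item w {#}#}" "ac_class t = word_class w" by blast
  have "ac_class (Times s t) = word_class (v @ w)"
    using Times.hyps[THEN monomial_terms_ST] vw by (auto simp: ST_def ac_class_Times)
  with vw show ?case by (intro exI[of _ "v @ w"]) simp
qed

lemma word_monomial_term:
  "w \<noteq> [] \<Longrightarrow> set w \<subseteq> X \<Longrightarrow> \<exists>t\<in>monomial_terms X. ac_class t = word_class w"
proof (induction w rule: list_nonempty_induct)
  case (single x)
  then show ?case by (intro bexI[of _ "Var x"]) (auto intro: monomial_terms.Var)
next
  case (cons x w)
  then obtain t where t: "t \<in> monomial_terms X" "ac_class t = word_class w" by auto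
  show ?case
  proof
    show "Times (Var x) t \<in> monomial_terms X"
      using t cons.prems by (auto intro!: monomial_terms.intros)
    show "ac_class (Times (Var x) t) = word_class (x # w)"
      using t monomial_terms_ST[OF t(1)] by (auto simp: ST_def ac_class_Times)
  qed
qed

lemma monomials_words: "monomials X = word_class ` {w. w \<noteq> [] \<and> set w \<subseteq> X}"
proof (intro equalityI subsetI)
  fix q assume "q \<in> monomials X"
  then obtain t where "t \<in> monomial_terms X" "q = ac_class t" by (auto simp: monomials_def)
  then show "q \<in> word_class ` {w. w \<noteq> [] \<and> set w \<subseteq> X}" using monomial_term_word[of t X] by blast
next
  fix q assume "q \<in> word_class ` {w. w \<noteq> [] \<and> set w \<subseteq> X}"
  then obtain w where w: "w \<noteq> []" "set w \<subseteq> X" "q = word_class w" by blast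
  then obtain t where "t \<in> monomial_terms X" "ac_class t = q" using word_monomial_term by blast
  then show "q \<in> monomials X" unfolding monomials_def by blast
qed

lemma PT_simple: "t \<in> PT X \<Longrightarrow> simple t" "t \<in> PT X \<Longrightarrow> vars t \<subseteq> X"
  using PT_subset_ST[of X] by (auto simp: ST_def)

text \<open>
On polynomial terms no use of right distributivity is made by \<open>nf\<close>, because the left factor of
each product is a monomial.  So the normal form still denotes the class of the term, and the
normal form separates AC-classes of polynomial terms.
\<close>

lemma embed_nf: "t \<in> PT X \<Longrightarrow> embed (nf t) = ac_class t"
proof (induction rule: PT.induct)
  case (monomial t)
  then show ?case using monomial_term_word by fastforce
next
  case (sum s t)
  then show ?case by (simp add: ac_class_Plus PT_simple)
next
  case (product s t)
  then obtain w where "nf s = {#Item w {#}#}" "ac_class s = word_class w"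
    using monomial_term_word by blast
  with product show ?case
    using monomial_terms_ST[OF product(1)]
    by (simp add: embed_prepend ac_class_Times PT_simple ST_def)
qed (simp_all add: ac_class_consts)

lemma prepend_eq_empty [simp]: "prepend w R = {#} \<longleftrightarrow> R = {#}"
  by (auto simp: prepend_def)

lemma nf_nonempty: "t \<in> PT X \<Longrightarrow> t \<noteq> Zero \<Longrightarrow> nf t \<noteq> {#}"
proof (induction rule: PT.induct)
  case (product s t)
  then show ?case using monomial_term_word[OF product(1)] by auto
qed (auto dest: monomial_term_word)

section \<open>Polynomials and id-reduced polynomials as multisets of items\<close>

lemma size_prepend: "w \<noteq> [] \<Longrightarrow> R \<noteq> {#} \<Longrightarrow> size (prepend w R) = 1"
  by (cases R rule: multiset_size_cases) (auto simp: prepend_sum)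

lemma size_nf_product:
  assumes "s \<in> monomial_terms X" "t \<in> PT X" "t \<noteq> Zero"
  shows "size (nf (Times s t)) = 1"
proof -
  obtain w where "w \<noteq> []" "nf s = {#Item w {#}#}" using monomial_term_word[OF assms(1)] by blast
  then show ?thesis using size_prepend[OF _ nf_nonempty[OF assms(2,3)]] by simp
qed

lemma size_nf_summand:
  assumes "t \<in> PT X" "t \<noteq> Zero" "summands t = [t]"
  shows "size (nf t) = 1"
  using assms(1)
proof cases
  case monomial
  then show ?thesis using monomial_term_word by fastforce
next
  case (sum u v)
  then show ?thesis
    using assms(3) summands_nonempty[of u] summands_nonempty[of v]
    by (cases "summands u"; cases "summands v") auto
next
  case (product s u)
  then show ?thesis using size_nf_product[of s X u] by simp
qed (use assms in auto)

lemma summands_summand: "u \<in> set (summands t) \<Longrightarrow> summands u = [u]"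
  by (induction t) auto

lemma nf_summands: "nf t = sum_list (map nf (summands t))"
  by (induction t) simp_all

lemma PT_PlusD: "Plus s t \<in> PT X \<Longrightarrow> s \<in> PT X \<and> t \<in> PT X \<and> s \<noteq> Zero \<and> t \<noteq> Zero"
  by (erule PT.cases) (auto elim: monomial_terms.cases)

lemma PT_TimesD: "Times s t \<in> PT X \<Longrightarrow> s \<in> monomial_terms X \<and> t \<in> PT X"
  by (erule PT.cases) (auto elim: monomial_terms.cases intro: PT.monomial)

lemma summands_PT: "t \<in> PT X \<Longrightarrow> t \<noteq> Zero \<Longrightarrow> u \<in> set (summands t) \<Longrightarrow> u \<in> PT X \<and> u \<noteq> Zero"
  by (induction t) (auto dest: PT_PlusD)

text \<open>
Summands in different AC-classes have different normal forms, which are singletons; so their sum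
has no repeated item.
\<close>

lemma sum_id_polys:
  assumes "sorted_wrt (\<lambda>u v. \<not> ac_eq u v) us"
    and "\<And>u. u \<in> set us \<Longrightarrow> u \<in> PT X \<and> size (nf u) = 1 \<and> nf u \<in> id_polys X"
  shows "sum_list (map nf us) \<in> id_polys X"
  using assms
proof (induction us)
  case (Cons u us)
  obtain i where i: "nf u = {#i#}"
    using Cons.prems(2)[of u] size_1_singleton_mset[of "nf u"] by auto
  have "i \<notin># sum_list (map nf us)"
  proof
    assume "i \<in># sum_list (map nf us)"
    then obtain v where v: "v \<in> set us" "i \<in># nf v"
      by (induction us) auto
    then have "nf v = {#i#}"
      using Cons.prems(2)[of v] size_1_singleton_mset[of "nf v"] by auto
    then have "ac_class u = ac_class v"
      using i Cons.prems(2)[of u] Cons.prems(2)[of v] v(1) embed_nf by (metis list.set_intros)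
    then have "ac_eq u v"
      using Cons.prems(2)[of u] Cons.prems(2)[of v] v(1) by (auto intro: ac_class_eqD PT_simple)
    then show False using Cons.prems(1) v(1) by auto
  qed
  moreover have "sum_list (map nf us) \<in> id_polys X"
    using Cons by simp
  moreover have "proper X i" "reduced i"
    using Cons.prems(2)[of u] i by (simp_all add: id_polys_add)
  ultimately show ?case using i by (simp add: id_polys_add)
qed simp

lemma nf_id_polys: "t \<in> ST_id X \<Longrightarrow> t \<in> PT X \<Longrightarrow> nf t \<in> id_polys X"
proof (induction rule: ST_id.induct)
  case (monomial t)
  then obtain w where "set w \<subseteq> X" "nf t = {#Item w {#}#}" using monomial_term_word by blast
  then show ?case by (simp add: id_polys_add)
next
  case (sum t)
  have "t \<noteq> Zero" using sum.hyps by (auto simp: sum_terms_def)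
  then have "u \<in> PT X \<and> size (nf u) = 1 \<and> nf u \<in> id_polys X" if "u \<in> set (summands t)" for u
    using that sum summands_PT size_nf_summand summands_summand by metis
  then show ?case using sum_id_polys sum.hyps nf_summands by metis
next
  case (product s t)
  then have "s \<in> monomial_terms X" "t \<in> PT X" by (auto dest: PT_TimesD)
  then show ?case using product monomial_term_word[of s X] by (auto simp: prepend_id_polys)
qed (simp_all add: id_polys_add)

text \<open>
The sum of a list of terms, without a trailing \<^const>\<open>Zero\<close>, which a simple term could not
contain.
\<close>

fun sum_term :: "'x trm list \<Rightarrow> 'x trm" where
  "sum_term [] = Zero"
| "sum_term [t] = t"
| "sum_term (t # ts) = Plus t (sum_term ts)"

lemma sum_term_PT: "ts \<noteq> [] \<Longrightarrow> set ts \<subseteq> PT X - {Zero} \<Longrightarrow> sum_term ts \<in> PT X - {Zero}"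
  by (induction ts rule: sum_term.induct) (auto intro: PT.sum)

lemma summands_sum_term_id:
  "ts \<noteq> [] \<Longrightarrow> \<forall>t\<in>set ts. summands t = [t] \<Longrightarrow> summands (sum_term ts) = ts"
  by (induction ts rule: sum_term.induct) auto

lemma ac_class_sum_term:
  "ts \<noteq> [] \<Longrightarrow> set ts \<subseteq> PT X - {Zero} \<Longrightarrow> ac_class (sum_term ts) = sum_list (map ac_class ts)"
proof (induction ts rule: sum_term.induct)
  case (3 t u us)
  then show ?case using sum_term_PT[of "u # us" X]
    by (simp add: ac_class_Plus PT_simple(1)[of _ X])
qed auto

text \<open>
A term witnessing that the class denoted by an item is a polynomial, and an id-reduced one if the
item is reduced.  The condition on \<^const>\<open>summands\<close> says that it is not a sum; so when such
terms are added, they form the sum-product decomposition.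
\<close>

definition represents :: "'x set \<Rightarrow> 'x item \<Rightarrow> 'x trm \<Rightarrow> bool" where
  "represents X i t \<longleftrightarrow> t \<in> PT X - {Zero} \<and> summands t = [t] \<and> ac_class t = embed_item i \<and>
     (reduced i \<longrightarrow> t \<in> ST_id X)"

text \<open>
Representatives of the items of \<open>M\<close> are added up.  Distinct items have distinct classes, so for
id-reduced \<open>M\<close> the summands are pairwise AC-inequivalent, as the clause for sums in
\<^const>\<open>ST_id\<close> demands.
\<close>

lemma sum_of_representatives:
  assumes "M \<in> polys X" "M \<noteq> {#}" "\<And>i. i \<in># M \<Longrightarrow> \<exists>t. represents X i t"
  shows "\<exists>t \<in> PT X - {Zero}. ac_class t = embed M \<and> (M \<in> id_polys X \<longrightarrow> t \<in> ST_id X) \<and>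
    (size M \<ge> 2 \<longrightarrow> (\<exists>u v. t = Plus u v \<and> u \<in> PT X - {Zero} \<and> v \<in> PT X - {Zero}))"
proof -
  obtain f where f: "\<And>i. i \<in># M \<Longrightarrow> represents X i (f i)" using assms(3) by metis
  obtain "is" where M: "mset is = M" using ex_mset by blast
  define ts where "ts = map f is"
  have ts: "ts \<noteq> []" "set ts \<subseteq> PT X - {Zero}" "\<forall>t\<in>set ts. summands t = [t]"
    "map ac_class ts = map embed_item is"
    using assms(2) f M by (auto simp: ts_def represents_def)
  note t = sum_term_PT[OF ts(1,2)] summands_sum_term_id[OF ts(1,3)]
  have Plus: "\<exists>u v. sum_term ts = Plus u v \<and> u \<in> PT X - {Zero} \<and> v \<in> PT X - {Zero}"
    if "size M \<ge> 2"
  proof -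
    have "length ts \<ge> 2" using that M by (auto simp: ts_def)
    then obtain u v us where us: "ts = u # v # us"
      by (metis One_nat_def Suc_1 Suc_le_length_iff)
    then show ?thesis using ts(2) sum_term_PT[of "v # us" X] by auto
  qed
  have "sum_term ts \<in> ST_id X" if red: "M \<in> id_polys X"
  proof -
    have elem: "u \<in> ST_id X" if "u \<in> set ts" for u
      using that f red M by (auto simp: ts_def represents_def id_polys_def)
    show ?thesis
    proof (cases "size M \<ge> 2")
      case True
      have "distinct is"
        unfolding distinct_count_atmost_1
      proof
        fix a
        have "count (mset is) a \<le> 1" using red M by (simp add: id_polys_def)
        moreover have "count (mset is) a > 0" if "a \<in> set is" using that by simp
        moreover have "count (mset is) a = 0" if "a \<notin> set is" using that by simp
        ultimately have "(a \<in> set is \<longrightarrow> count (mset is) a = 1) \<and>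
            (a \<notin> set is \<longrightarrow> count (mset is) a = 0)" by linarith
        then show "count (mset is) a = (if a \<in> set is then 1 else 0)" by argo
      qed
      moreover have "inj_on embed_item (set is)"
        using assms(1) M embed_item_inj[of X] by (auto simp: inj_on_def polys_def)
      ultimately have "distinct (map ac_class ts)" unfolding ts(4) by (simp add: distinct_map)
      then have "sorted_wrt (\<lambda>u v. ac_class u \<noteq> ac_class v) ts"
        by (simp add: distinct_conv_nth sorted_wrt_iff_nth_less)
      then have sorted: "sorted_wrt (\<lambda>u v. \<not> ac_eq u v) ts"
      proof (rule sorted_wrt_mono_rel[rotated])
        show "\<not> ac_eq u v" if "u \<in> set ts" "v \<in> set ts" "ac_class u \<noteq> ac_class v" for u v
        proof
          assume "ac_eq u v"
          moreover have "simple u" "simple v" using that ts(2) by (auto intro: PT_simple)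
          ultimately have "ac_class u = ac_class v"
            using Quotient_rel[OF Quotient_nsb, of u v] by simp
          with that(3) show False by simp
        qed
      qed
      show ?thesis
      proof (rule ST_id.sum)
        show "sum_term ts \<in> sum_terms X"
          using Plus[OF True] PT_subset_ST[of X] unfolding sum_terms_def by blast
        show "sorted_wrt (\<lambda>u v. \<not> ac_eq u v) (summands (sum_term ts))"
          unfolding t(2) by (rule sorted)
        show "u \<in> ST_id X" if "u \<in> set (summands (sum_term ts))" for u
          using that unfolding t(2) by (rule elem)
      qed
    next
      case False
      moreover have "length ts = size M" using M by (auto simp: ts_def)
      moreover have "length ts \<noteq> 0" using ts(1) by simp
      ultimately have "length ts = 1" by linarith
      then obtain t where "ts = [t]" by (auto simp: length_Suc_conv)
      then show ?thesis using elem by simp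
    qed
  qed
  moreover have "ac_class (sum_term ts) = embed M"
    using ac_class_sum_term[OF ts(1,2)] ts(4) embed_mset[of "is"] M by simp
  ultimately show ?thesis using Plus t(1) by blast
qed

lemma proper_represented: "proper X i \<Longrightarrow> \<exists>t. represents X i t"
proof (induction i)
  case (Item w P)
  show ?case
  proof (cases "P = {#}")
    case True
    show ?thesis
    proof (cases "w = []")
      case True
      with \<open>P = {#}\<close> have "represents X (Item w P) One"
        by (auto simp: represents_def ac_class_consts intro: PT.intros ST_id.intros)
      then show ?thesis ..
    next
      case False
      then obtain t where t: "t \<in> monomial_terms X" "ac_class t = word_class w"
        using word_monomial_term[of w X] Item.prems by auto
      then have "summands t = [t]" by cases auto
      then have "represents X (Item w P) t"
        using t \<open>P = {#}\<close> monomial_terms_ST[OF t(1)]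
        by (auto simp: represents_def intro: PT.monomial ST_id.monomial)
      then show ?thesis ..
    qed
  next
    case False
    then have P: "P \<in> polys X" "w \<noteq> []" "set w \<subseteq> X" "size P \<ge> 2"
      using Item.prems by (auto simp: polys_def)
    have "\<exists>t. represents X i t" if "i \<in># P" for i
      using Item.IH[OF that] Item.prems that by auto
    with sum_of_representatives[OF P(1) False] P(4)
    obtain t u v where t: "t \<in> PT X - {Zero}" "ac_class t = embed P"
      "P \<in> id_polys X \<longrightarrow> t \<in> ST_id X" "t = Plus u v" by blast
    obtain s where s: "s \<in> monomial_terms X" "ac_class s = word_class w"
      using word_monomial_term P by blast
    have "simple t" using t(1) by (auto intro: PT_simple)
    then have "ac_class (Times s t) = embed_item (Item w P)"
      using s t False monomial_terms_ST[OF s(1)] by (auto simp: ST_def ac_class_Times)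
    moreover have "reduced (Item w P) \<Longrightarrow> P \<in> id_polys X"
      using P(1) by (auto simp: id_polys_def)
    ultimately have "represents X (Item w P) (Times s t)"
      using s t(1,3,4) monomial_terms_ST[OF s(1)]
      by (auto simp: represents_def intro: PT.product ST_id.product ST_id.monomial)
    then show ?thesis ..
  qed
qed

lemma polys_term:
  assumes "M \<in> polys X" "M \<noteq> {#}"
  shows "\<exists>t \<in> PT X - {Zero}. ac_class t = embed M \<and> (M \<in> id_polys X \<longrightarrow> t \<in> ST_id X) \<and>
    (size M \<ge> 2 \<longrightarrow> (\<exists>u v. t = Plus u v \<and> u \<in> PT X - {Zero} \<and> v \<in> PT X - {Zero}))"
  by (rule sum_of_representatives[OF assms], rule proper_represented)
    (use assms(1) in \<open>simp add: polys_def\<close>)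

lemma N_rd_embed: "N_rd X = embed ` polys X"
proof (intro equalityI subsetI)
  fix p assume "p \<in> N_rd X"
  then obtain t where t: "t \<in> PT X" "p = ac_class t" by (auto simp: N_rd_def)
  show "p \<in> embed ` polys X"
  proof
    show "p = embed (nf t)" using t embed_nf[OF t(1)] by simp
    show "nf t \<in> polys X" using nf_polys[OF PT_simple(2)[OF t(1)]] .
  qed
next
  fix p assume "p \<in> embed ` polys X"
  then obtain M where M: "M \<in> polys X" "p = embed M" by blast
  show "p \<in> N_rd X"
  proof (cases "M = {#}")
    case True
    then have "p = ac_class Zero" using M by (simp add: ac_class_consts)
    then show ?thesis unfolding N_rd_def using PT.Zero by (rule image_eqI)
  next
    case False
    then obtain t where "t \<in> PT X" "ac_class t = embed M" using polys_term[OF M(1)] by blast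
    then have "t \<in> PT X" "p = ac_class t" using M(2) by simp_all
    then show ?thesis unfolding N_rd_def by blast
  qed
qed

lemma B_id_rd_embed: "B_id_rd_set X = embed ` id_polys X"
proof (intro equalityI subsetI)
  fix p assume "p \<in> B_id_rd_set X"
  then obtain t where t: "t \<in> PT X" "t \<in> ST_id X" "p = ac_class t"
    by (auto simp: B_id_rd_set_def PT_id_def)
  show "p \<in> embed ` id_polys X"
  proof
    show "p = embed (nf t)" using t embed_nf[OF t(1)] by simp
    show "nf t \<in> id_polys X" using nf_id_polys[OF t(2,1)] .
  qed
next
  fix p assume "p \<in> embed ` id_polys X"
  then obtain M where M: "M \<in> id_polys X" "p = embed M" by blast
  show "p \<in> B_id_rd_set X"
  proof (cases "M = {#}")
    case True
    then have "p = ac_class Zero" using M by (simp add: ac_class_consts)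
    moreover have "Zero \<in> PT_id X" unfolding PT_id_def using PT.Zero ST_id.Zero by blast
    ultimately show ?thesis unfolding B_id_rd_set_def by (rule image_eqI)
  next
    case False
    have "M \<in> polys X" using M(1) by (simp add: id_polys_def)
    then obtain t where "t \<in> PT X" "t \<in> ST_id X" "ac_class t = embed M"
      using polys_term[OF _ False] M(1) by blast
    then have "t \<in> PT X" "t \<in> ST_id X" "p = ac_class t" using M(2) by simp_all
    then show ?thesis unfolding B_id_rd_set_def PT_id_def by blast
  qed
qed


section \<open>The operations in terms of multisets of items\<close>

lemma sum_list_times: "sum_list Ms \<star> R = sum_list (map (\<lambda>M. M \<star> R) Ms)"
  by (induction Ms) simp_all

text \<open>
Each clause of the recursion is a law of the model: the clause for sums is right distributivity,
the clause for products is associativity.  Hence all ways of running the recursion agree.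
\<close>

lemma rd_graph_embed: "rd_graph X q r p \<Longrightarrow> p = embed (nf_class q \<star> nf_class r)"
proof (induction rule: rd_graph.induct)
  case (one_right q)
  then obtain M where "M \<in> polys X" "q = embed M" by (auto simp: N_rd_embed)
  then show ?case by (simp add: nf_embed times_items_one)
next
  case (one_left q)
  then obtain M where "M \<in> polys X" "q = embed M" by (auto simp: N_rd_embed)
  then show ?case by (simp add: nf_embed)
next
  case (monomial q r)
  then obtain M where M: "M \<in> polys X" "r = embed M" by (auto simp: N_rd_embed)
  obtain w where "q = word_class w" using monomial by (auto simp: monomials_words)
  with M show ?case by (simp add: nf_embed embed_prepend)
next
  case (sum qs r ps)
  have "ps = map (\<lambda>q. embed (nf_class q \<star> nf_class r)) qs"
    using sum by (intro nth_equalityI) simp_all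
  then show ?case
    by (simp add: nf_class_sum_list sum_list_times embed_sum_list comp_def)
next
  case (product m q' r p)
  obtain w where "m = word_class w" using product by (auto simp: monomials_words)
  with product show ?case by (simp add: embed_prepend times_prepend)
qed (simp_all add: times_zero_right)

lemma embed_sum_polys:
  assumes "P \<in> polys X" "size P \<ge> 2"
  shows "embed P \<in> sum_polys X"
proof -
  have "P \<noteq> {#}" using assms(2) by auto
  with polys_term[OF assms(1)] assms(2) show ?thesis
    unfolding sum_polys_def by fastforce
qed

lemma embed_product_polys:
  assumes "w \<noteq> []" "set w \<subseteq> X" "P \<in> polys X" "size P \<ge> 2"
  shows "word_class w * embed P \<in> product_polys X"
proof -
  obtain s where s: "s \<in> monomial_terms X" "ac_class s = word_class w"
    using word_monomial_term[OF assms(1,2)] by blast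
  obtain u v where uv: "Plus u v \<in> PT X" "ac_class (Plus u v) = embed P"
  proof -
    have "P \<noteq> {#}" using assms(4) by auto
    with polys_term[OF assms(3)] assms(4) show thesis using that by blast
  qed
  have "word_class w * embed P = ac_class (Times s (Plus u v))"
    using s uv monomial_terms_ST[OF s(1)] PT_simple(1)[OF uv(1)]
    by (simp add: ac_class_Times ST_def)
  then show ?thesis using s(1) uv(1) unfolding product_polys_def by blast
qed

lemma word_product_polys:
  assumes "length w \<ge> 2" "set w \<subseteq> X"
  shows "word_class w \<in> product_polys X"
proof -
  obtain x v where w: "w = x # v" "v \<noteq> []" using assms(1) by (cases w) fastforce+
  obtain t where t: "t \<in> monomial_terms X" "ac_class t = word_class v"
    using word_monomial_term[of v X] w assms(2) by auto
  have "Var x \<in> monomial_terms X" using w assms(2) by (auto intro: monomial_terms.Var)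
  moreover have "t \<in> PT X - {Zero, One}"
    using t(1) monomial_terms_ST[OF t(1)] by (auto intro: PT.monomial)
  moreover have "word_class w = ac_class (Times (Var x) t)"
    using t w monomial_terms_ST[OF t(1)] by (simp add: ac_class_Times ST_def)
  ultimately show ?thesis unfolding product_polys_def by blast
qed

lemma embed_item_summand:
  assumes "proper X i"
  shows "embed_item i \<in> product_polys X \<union> var_classes X \<union> {1}"
proof (cases i)
  case (Item w P)
  consider "w = []" "P = {#}" | x where "w = [x]" "P = {#}"
    | "length w \<ge> 2" "P = {#}"
    | "P \<noteq> {#}" "w \<noteq> []" "size P \<ge> 2"
    using assms Item by (cases w; cases "tl w"; cases "P = {#}") auto
  then show ?thesis
  proof cases
    case 4
    have "P \<in> polys X" using assms Item by (simp add: polys_def)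
    then show ?thesis using assms Item 4 embed_product_polys[of w X P] by simp
  qed (use assms Item word_product_polys[of w X] in \<open>auto simp: var_classes_def\<close>)
qed

text \<open>
A value for a multiset of items is found from values for the items.  The clause for sums applies
only to two or more summands; the other sizes use the clauses for \<open>0\<close> and the value of the one
item.
\<close>

lemma rd_graph_sum:
  assumes "M \<in> polys X" "r \<in> N_rd X - {0, 1}"
    and "\<And>i. i \<in># M \<Longrightarrow> \<exists>p. rd_graph X (embed_item i) r p"
  shows "\<exists>p. rd_graph X (embed M) r p"
proof -
  consider "M = {#}" | i where "M = {#i#}" | "size M \<ge> 2" by (metis multiset_size_cases)
  then show ?thesis
  proof cases
    case 1
    then show ?thesis using rd_graph.zero_left[of r X] assms(2) by auto
  next
    case 2
    then show ?thesis using assms(3) by simp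
  next
    case 3
    obtain "is" where "is": "mset is = M" using ex_mset by blast
    obtain f where f: "\<And>i. i \<in># M \<Longrightarrow> rd_graph X (embed_item i) r (f i)" using assms(3) by metis
    have "rd_graph X (sum_list (map embed_item is)) r (sum_list (map f is))"
    proof (rule rd_graph.sum)
      show "length (map embed_item is) \<ge> 2" using 3 "is" by auto
      show "set (map embed_item is) \<subseteq> product_polys X \<union> var_classes X \<union> {1}"
      proof
        fix q assume "q \<in> set (map embed_item is)"
        then obtain i where i: "i \<in> set is" "q = embed_item i" by auto
        then have "proper X i" using assms(1) "is" by (auto simp: polys_def)
        then show "q \<in> product_polys X \<union> var_classes X \<union> {1}"
          unfolding i(2) by (rule embed_item_summand)
      qed
      show "r \<in> N_rd X - {0, 1}" by (rule assms(2))
      show "length (map f is) = length (map embed_item is)" by simp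
      show "rd_graph X (map embed_item is ! k) r (map f is ! k)"
        if "k < length (map embed_item is)" for k
        using that f "is" by auto
    qed
    then show ?thesis using embed_mset[of "is"] "is" by auto
  qed
qed

lemma rd_graph_item:
  assumes "r \<in> N_rd X - {0, 1}"
  shows "proper X i \<Longrightarrow> \<exists>p. rd_graph X (embed_item i) r p"
proof (induction i)
  case (Item w P)
  then have P: "P \<in> polys X" and w: "set w \<subseteq> X" by (auto simp: polys_def)
  have m: "word_class w \<in> monomials X" if "w \<noteq> []" using that w by (auto simp: monomials_words)
  show ?case
  proof (cases "P = {#}")
    case True
    then show ?thesis using rd_graph.one_left[of r X] rd_graph.monomial[OF m assms] assms
      by (cases "w = []") auto
  next
    case False
    then have *: "w \<noteq> []" "size P \<ge> 2" using Item.prems by auto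
    have "\<exists>p. rd_graph X (embed_item i) r p" if "i \<in># P" for i
      using Item.IH[OF that] Item.prems that by auto
    then obtain p where "rd_graph X (embed P) r p" using rd_graph_sum[OF P assms] by blast
    then have "rd_graph X (word_class w * embed P) r (word_class w * p)"
      by (rule rd_graph.product[OF m[OF *(1)] embed_sum_polys[OF P *(2)] assms])
    then show ?thesis using False by auto
  qed
qed

lemma rd_mult_embed:
  assumes "M \<in> polys X" "R \<in> polys X"
  shows "rd_mult X (embed M) (embed R) = embed (M \<star> R)"
proof -
  have N: "embed M \<in> N_rd X" "embed R \<in> N_rd X" using assms by (auto simp: N_rd_embed)
  have "\<exists>p. rd_graph X (embed M) (embed R) p"
  proof (cases "embed R \<in> {0, 1}")
    case True
    then show ?thesis using rd_graph.zero_right[OF N(1)] rd_graph.one_right[OF N(1)] by auto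
  next
    case False
    then have R: "embed R \<in> N_rd X - {0, 1}" using N(2) by blast
    show ?thesis
      by (rule rd_graph_sum[OF assms(1) R], rule rd_graph_item[OF R])
        (use assms(1) in \<open>simp add: polys_def\<close>)
  qed
  then obtain p where p: "rd_graph X (embed M) (embed R) p" by blast
  have unique: "p' = embed (M \<star> R)" if "rd_graph X (embed M) (embed R) p'" for p'
    using rd_graph_embed[OF that] assms by (simp add: nf_embed)
  show ?thesis unfolding rd_mult_def
    using p unique by (metis the_equality)
qed

lemma product_poly_item:
  assumes "q \<in> product_polys X"
  shows "\<exists>i. proper X i \<and> q = embed_item i"
proof -
  obtain s t where st: "q = ac_class (Times s t)" "s \<in> monomial_terms X" "t \<in> PT X - {Zero, One}"
    using assms unfolding product_polys_def by blast
  then have PT: "Times s t \<in> PT X" by (auto intro: PT.product)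
  obtain i where i: "nf (Times s t) = {#i#}"
    using size_nf_product[OF st(2), of t] st(3) size_1_singleton_mset by auto
  have "proper X i" using nf_polys[OF PT_simple(2)[OF PT]] i by simp
  moreover have "q = embed_item i" using embed_nf[OF PT] st(1) i by simp
  ultimately show ?thesis by blast
qed

lemma id_summands_embed:
  "{1} \<union> monomials X \<union> (product_polys X \<inter> B_id_rd_set X) = embed_item ` {i. proper X i \<and> reduced i}"
proof (intro equalityI subsetI)
  fix q assume "q \<in> {1} \<union> monomials X \<union> (product_polys X \<inter> B_id_rd_set X)"
  then consider "q = 1" | "q \<in> monomials X" | "q \<in> product_polys X" "q \<in> B_id_rd_set X" by blast
  then show "q \<in> embed_item ` {i. proper X i \<and> reduced i}"
  proof cases
    case 1
    then show ?thesis by (intro image_eqI[of _ _ "Item [] {#}"]) simp_all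
  next
    case 2
    then obtain w where "set w \<subseteq> X" "q = word_class w" by (auto simp: monomials_words)
    then show ?thesis by (intro image_eqI[of _ _ "Item w {#}"]) simp_all
  next
    case 3
    obtain i where i: "proper X i" "q = embed_item i" using product_poly_item[OF 3(1)] by blast
    obtain M where M: "M \<in> id_polys X" "q = embed M" using 3(2) by (auto simp: B_id_rd_embed)
    have "M = {#i#}"
      using M i nf_embed[of M X] nf_embed_item[of X i] by (simp add: id_polys_def)
    then show ?thesis using M i by (simp add: id_polys_add)
  qed
next
  fix q assume "q \<in> embed_item ` {i. proper X i \<and> reduced i}"
  then obtain i where i: "proper X i" "reduced i" "q = embed_item i" by blast
  then have "{#i#} \<in> id_polys X" by (simp add: id_polys_add)
  then have "q \<in> B_id_rd_set X" unfolding B_id_rd_embed using i(3) by (intro image_eqI) simp_all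
  moreover have "var_classes X \<subseteq> monomials X"
    unfolding var_classes_def monomials_def by (auto intro: monomial_terms.Var)
  ultimately show "q \<in> {1} \<union> monomials X \<union> (product_polys X \<inter> B_id_rd_set X)"
    using embed_item_summand[OF i(1)] i(3) by blast
qed

lemma id_polys_distinct:
  assumes "mset is \<in> polys X"
  shows "mset is \<in> id_polys X \<longleftrightarrow> distinct is \<and> (\<forall>i\<in>set is. reduced i)"
  using assms by (induction "is") (auto simp: id_polys_add)

text \<open>
By injectivity of \<^const>\<open>embed\<close>, the decompositions of an id-reduced polynomial are exactly the
enumerations of its items.
\<close>

lemma id_decomposition_embed:
  assumes "M \<in> id_polys X" "M \<noteq> {#}"
  shows "id_decomposition X (embed M) qs \<longleftrightarrow> (\<exists>is. qs = map embed_item is \<and> mset is = M)"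
proof
  assume *: "id_decomposition X (embed M) qs"
  then have "set qs \<subseteq> embed_item ` {i. proper X i \<and> reduced i}"
    unfolding id_decomposition_def id_summands_embed by blast
  then have "qs \<in> lists (embed_item ` {i. proper X i \<and> reduced i})" by auto
  then obtain "is" where "is": "qs = map embed_item is" "\<forall>i\<in>set is. proper X i"
    unfolding lists_image by auto
  then have "embed M = embed (mset is)" using * by (simp add: id_decomposition_def embed_mset)
  moreover have "mset is \<in> polys X" "M \<in> polys X" using "is" assms by (auto simp: polys_def id_polys_def)
  ultimately have "mset is = M" using embed_inj by metis
  with "is" show "\<exists>is. qs = map embed_item is \<and> mset is = M" by blast
next
  assume "\<exists>is. qs = map embed_item is \<and> mset is = M"
  then obtain "is" where "is": "qs = map embed_item is" "mset is = M" by blast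
  have M: "\<forall>i\<in>set is. proper X i \<and> reduced i" "distinct is"
    using assms(1) id_polys_distinct[of "is" X] "is" by (auto simp: id_polys_def polys_def)
  then have "inj_on embed_item (set is)" using embed_item_inj[of X] by (auto simp: inj_on_def)
  with M have "distinct qs" using "is" by (simp add: distinct_map)
  moreover have "set qs \<subseteq> embed_item ` {i. proper X i \<and> reduced i}" using M "is" by auto
  moreover have "length qs \<ge> 1" using assms(2) "is" by (cases "is") auto
  ultimately show "id_decomposition X (embed M) qs"
    unfolding id_decomposition_def id_summands_embed using "is" embed_mset[of "is"] by simp
qed

lemma union_mset_filter:
  assumes "\<forall>i. count A i \<le> 1" "\<forall>i. count B i \<le> 1"
  shows "A \<union># B = A + filter_mset (\<lambda>i. i \<notin># A) B"
proof (rule multiset_eqI)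
  fix i
  have "count A i \<le> 1" "count B i \<le> 1" using assms by auto
  then consider "count A i = 0" | "count A i = 1" by linarith
  then show "count (A \<union># B) i = count (A + filter_mset (\<lambda>i. i \<notin># A) B) i"
  proof cases
    case 1
    then have "i \<notin># A" by (simp add: not_in_iff)
    with 1 show ?thesis by simp
  next
    case 2
    then have "i \<in># A" by (simp flip: count_greater_zero_iff)
    with 2 \<open>count B i \<le> 1\<close> show ?thesis by simp
  qed
qed

text \<open>
For all choices of the two decompositions the result is the same: the items of the first
polynomial, and those of the second that are not among them, which is the union of the two
multisets as no item occurs twice.
\<close>

lemma id_add_embed:
  assumes "A \<in> id_polys X" "B \<in> id_polys X"
  shows "id_add X (embed A) (embed B) = embed (A \<union># B)"
proof -
  have zero: "embed M = 0 \<longleftrightarrow> M = {#}" if "M \<in> id_polys X" for M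
    using embed_inj[of M X "{#}"] that by (simp add: id_polys_def)
  show ?thesis
  proof (cases "A = {#} \<or> B = {#}")
    case True
    then show ?thesis using zero assms by (auto simp: id_add_def)
  next
    case False
    then have ne: "A \<noteq> {#}" "B \<noteq> {#}" by auto
    let ?sum = "\<lambda>qs rs. sum_list qs + sum_list (filter (\<lambda>r'. r' \<notin> set qs) rs)"
    have sum: "?sum (map embed_item is) (map embed_item js) = embed (A \<union># B)"
      if "mset is = A" "mset js = B" for "is" js
    proof -
      have proper: "\<forall>i\<in>set is. proper X i" "\<forall>j\<in>set js. proper X j"
        using assms that by (auto simp: id_polys_def polys_def)
      have "filter (\<lambda>j. embed_item j \<notin> embed_item ` set is) js = filter (\<lambda>j. j \<notin> set is) js"
        using proper embed_item_inj[of X] by (intro filter_cong) auto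
      then have "?sum (map embed_item is) (map embed_item js) =
          embed (mset is + mset (filter (\<lambda>j. j \<notin> set is) js))"
        by (simp add: embed_mset filter_map comp_def del: mset_filter)
      also have "mset is + mset (filter (\<lambda>j. j \<notin> set is) js) = A \<union># B"
        using union_mset_filter[of A B] assms that by (auto simp: id_polys_def)
      finally show ?thesis .
    qed
    obtain "is" js where lists: "mset is = A" "mset js = B" using ex_mset by metis
    have "(THE p. \<exists>qs rs. id_decomposition X (embed A) qs \<and> id_decomposition X (embed B) rs \<and>
        p = ?sum qs rs) = embed (A \<union># B)" (is "The ?P = _")
    proof (rule the_equality)
      show "?P (embed (A \<union># B))"
        unfolding id_decomposition_embed[OF assms(1) ne(1)] id_decomposition_embed[OF assms(2) ne(2)]
      proof (intro exI conjI)
        show "map embed_item is = map embed_item is" "map embed_item js = map embed_item js"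
          by simp_all
        show "mset is = A" "mset js = B" by (fact lists)+
        show "embed (A \<union># B) = ?sum (map embed_item is) (map embed_item js)"
          by (rule sum[OF lists, symmetric])
      qed
      show "p = embed (A \<union># B)" if "?P p" for p
        using that sum
        unfolding id_decomposition_embed[OF assms(1) ne(1)] id_decomposition_embed[OF assms(2) ne(2)]
        by blast
    qed
    then show ?thesis using zero[OF assms(1)] zero[OF assms(2)] ne by (simp add: id_add_def)
  qed
qed

theorem theorem4p26:
  fixes X :: "'x set"
  assumes "X \<noteq> {}"
  shows "strong_bimonoid (B_id_rd X) \<and> right_distributive (B_id_rd X) \<and>
    idempotent_addition (B_id_rd X)"
proof -
  let ?B = "B_id_rd X"
  have carrier: "carrier ?B = embed ` id_polys X"
    by (simp add: B_id_rd_def B_id_rd_embed)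
  have polys: "A \<in> polys X" if "A \<in> id_polys X" for A using that by (simp add: id_polys_def)
  have add: "embed A \<oplus>\<^bsub>?B\<^esub> embed B = embed (A \<union># B)"
    if "A \<in> id_polys X" "B \<in> id_polys X" for A B
    using that by (simp add: B_id_rd_def id_add_embed)
  have mult: "embed A \<otimes>\<^bsub>?B\<^esub> embed B = embed (A \<star> B)"
    if "A \<in> id_polys X" "B \<in> id_polys X" for A B
    using that by (simp add: B_id_rd_def rd_mult_embed polys)
  have zero_one: "\<zero>\<^bsub>?B\<^esub> = embed {#}" "\<one>\<^bsub>?B\<^esub> = embed one_items"
    by (simp_all add: B_id_rd_def)
  have one: "one_items \<in> id_polys X" by (simp add: id_polys_add)
  note closed = union_id_polys times_id_polys one empty_id_polys
  have union_ac: "(A \<union># B) \<union># C = A \<union># (B \<union># C)" "A \<union># B = B \<union># A"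
    "A \<union># (B \<union># C) = B \<union># (A \<union># C)" for A B C :: "'x item multiset"
    by (simp_all add: multiset_eq_iff max.assoc max.commute max.left_commute)
  have "abelian_monoid ?B"
    by (rule abelian_monoidI)
      (auto simp: carrier add zero_one closed union_ac simp del: embed_simps)
  moreover have "monoid ?B"
    by (rule monoidI)
      (auto simp: carrier mult zero_one closed times_items_assoc times_items_one[OF polys] simp del: embed_simps)
  moreover have "strong_bimonoid_axioms ?B"
    by unfold_locales
      (auto simp: carrier mult zero_one closed times_zero_right simp del: embed_simps)
  moreover have "right_distributive ?B"
    by (auto simp: right_distributive_def carrier add mult closed union_times_id)
  moreover have "idempotent_addition ?B"
    by (auto simp: idempotent_addition_def carrier add)
  ultimately show ?thesis by (simp add: strong_bimonoid_def)
qed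

end
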